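(* Let $\lambda\ge0$, $T>0$, and let $\gamma\colon[0,T)\times\mathbb{S}^1\to\mathbb{R}^2$ be a sufficiently smooth family of regular closed curves solving $$\partial_t^\perp\gamma=\nabla_s^2\Big(\nabla_s^2\kappa+\tfrac12|\kappa|^2\kappa-\lambda\kappa\Big).$$ Then $$\frac{\mathrm{d}}{\mathrm{d}t}\mathcal{E}_\lambda(\gamma)=-\int_{\mathbb{S}^1}\Big|\nabla_s\Big(\nabla_s^2\kappa+\tfrac12|\kappa|^2\kappa-\lambda\kappa\Big)\Big|^2\,\mathrm{d}s\le 0 .$$
   Context: For a regular curve $\gamma\colon\mathbb{S}^1\to\mathbb{R}^2$ ($\partial_x\gamma\ne0$): $\partial_s=|\partial_x\gamma|^{-1}\partial_x$, $\mathrm{d}s=|\partial_x\gamma|\,\mathrm{d}x$, $\kappa=\partial_s^2\gamma$ is the curvature vector. For a vector field $\phi$ along $\gamma$, $P^\perp\phi=\phi-\langle\phi,\partial_s\gamma\rangle\partial_s\gamma$, $\nabla_s=P^\perp\partial_s$, $\partial_t^\perp=P^\perp\partial_t$; for time-dependent $\gamma$ these are taken for each $\gamma(t,\cdot)$. The energy is $\mathcal{E}_\lambda(\gamma)=\frac12\int_{\mathbb{S}^1}\big(|\kappa|^2+2\lambda\big)\,\mathrm{d}s$. "Sufficiently smooth" means of class $C^k$ jointly in $(t,x)$ for some sufficiently large $k$. Only the normal velocity is prescribed; the tangential velocity $\langle\partial_t\gamma,\partial_s\gamma\rangle$ is arbitrary. *)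

theory Defs
  imports "HOL-Analysis.Analysis"
begin

text \<open>
  Maps on the circle are represented by \<open>2\<pi>\<close>-periodic functions of a real variable \<open>x\<close>.
  A curve, and likewise a vector field along it, has type \<open>real \<Rightarrow> real ^ 2\<close>;
  a family of curves is curried, time first.
\<close>

text \<open>
  Class \<open>C\<^sup>k\<close> on \<open>S\<close>. Derivatives are taken within \<open>S\<close>, so that on \<open>[0,T) \<times> \<real>\<close> they are
  one-sided in time at \<open>t = 0\<close>; there they are unique.
\<close>

primrec Ck_on :: "nat \<Rightarrow> 'a::real_normed_vector set \<Rightarrow> ('a \<Rightarrow> 'b::real_normed_vector) \<Rightarrow> bool" where
  "Ck_on 0 S f \<longleftrightarrow> continuous_on S f"
| "Ck_on (Suc k) S f \<longleftrightarrow>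
     (\<exists>f'. (\<forall>p\<in>S. (f has_derivative f' p) (at p within S)) \<and> (\<forall>v. Ck_on k S (\<lambda>p. f' p v)))"

definition speed :: "(real \<Rightarrow> real ^ 2) \<Rightarrow> real \<Rightarrow> real" where
  "speed \<gamma> x = norm (vector_derivative \<gamma> (at x))"

definition regular_closed_curve :: "(real \<Rightarrow> real ^ 2) \<Rightarrow> bool" where
  "regular_closed_curve \<gamma> \<longleftrightarrow>
     (\<forall>x. \<gamma> (x + 2 * pi) = \<gamma> x) \<and>
     (\<forall>x. \<gamma> differentiable (at x) \<and> vector_derivative \<gamma> (at x) \<noteq> 0)"

definition arc_deriv :: "(real \<Rightarrow> real ^ 2) \<Rightarrow> (real \<Rightarrow> real ^ 2) \<Rightarrow> real \<Rightarrow> real ^ 2" where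
  "arc_deriv \<gamma> \<phi> x = (1 / speed \<gamma> x) *\<^sub>R vector_derivative \<phi> (at x)"

definition arc_integral :: "(real \<Rightarrow> real ^ 2) \<Rightarrow> (real \<Rightarrow> real) \<Rightarrow> real" where
  "arc_integral \<gamma> f = integral {0..2 * pi} (\<lambda>x. f x * speed \<gamma> x)"

definition tangent :: "(real \<Rightarrow> real ^ 2) \<Rightarrow> real \<Rightarrow> real ^ 2" where
  "tangent \<gamma> = arc_deriv \<gamma> \<gamma>"

definition curvature :: "(real \<Rightarrow> real ^ 2) \<Rightarrow> real \<Rightarrow> real ^ 2" where
  "curvature \<gamma> = arc_deriv \<gamma> (arc_deriv \<gamma> \<gamma>)"

definition normal_proj :: "(real \<Rightarrow> real ^ 2) \<Rightarrow> (real \<Rightarrow> real ^ 2) \<Rightarrow> real \<Rightarrow> real ^ 2" where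
  "normal_proj \<gamma> \<phi> x = \<phi> x - (\<phi> x \<bullet> tangent \<gamma> x) *\<^sub>R tangent \<gamma> x"

definition nabla_s :: "(real \<Rightarrow> real ^ 2) \<Rightarrow> (real \<Rightarrow> real ^ 2) \<Rightarrow> real \<Rightarrow> real ^ 2" where
  "nabla_s \<gamma> \<phi> = normal_proj \<gamma> (arc_deriv \<gamma> \<phi>)"

definition normal_velocity :: "real \<Rightarrow> (real \<Rightarrow> real \<Rightarrow> real ^ 2) \<Rightarrow> real \<Rightarrow> real \<Rightarrow> real ^ 2" where
  "normal_velocity T \<gamma> t =
     normal_proj (\<gamma> t) (\<lambda>x. vector_derivative (\<lambda>\<tau>. \<gamma> \<tau> x) (at t within {0..<T}))"

definition elastic_energy :: "real \<Rightarrow> (real \<Rightarrow> real ^ 2) \<Rightarrow> real" where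
  "elastic_energy l \<gamma> = 1 / 2 * arc_integral \<gamma> (\<lambda>x. (norm (curvature \<gamma> x))\<^sup>2 + 2 * l)"

definition elastic_gradient :: "real \<Rightarrow> (real \<Rightarrow> real ^ 2) \<Rightarrow> real \<Rightarrow> real ^ 2" where
  "elastic_gradient l \<gamma> x =
     nabla_s \<gamma> (nabla_s \<gamma> (curvature \<gamma>)) x
     + (1 / 2 * (norm (curvature \<gamma> x))\<^sup>2) *\<^sub>R curvature \<gamma> x
     - l *\<^sub>R curvature \<gamma> x"

end

(* Write V for the full velocity, g for the speed, \<tau> for the unit tangent and s for arc length.
   The normal field F = \<nabla>\<^sub>s\<^sup>2\<kappa> + |\<kappa>|\<^sup>2\<kappa>/2 - l\<kappa> equals
   \<partial>\<^sub>s(\<partial>\<^sub>s\<kappa> + (3|\<kappa>|\<^sup>2/2 - l)\<tau>), in divergence form. The time derivative of the energy density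
   is g(<\<kappa>, \<partial>\<^sub>s\<^sup>2V> - (3|\<kappa>|\<^sup>2/2 - l)<\<tau>, \<partial>\<^sub>sV>), so up to an exact derivative it is g<F, V>.
   As F is normal, only the normal part \<nabla>\<^sub>s\<^sup>2F of V matters, and g<F, \<nabla>\<^sub>s\<^sup>2F> is -g|\<nabla>\<^sub>sF|\<^sup>2 up to
   a further exact derivative. Exact derivatives of periodic functions integrate to zero. *)

theory Submission imports Defs begin

section \<open>Closure properties of the class \<open>C\<^sup>k\<close>\<close>

text \<open>The recursion speaks only about derivatives, so the drop in order is an induction:
  differentiability gives continuity at order 0, and the step applies the hypothesis to every
  directional derivative.\<close>

lemma Ck_on_SucD: "Ck_on (Suc k) S f \<Longrightarrow> Ck_on k S f"
proof (induction k arbitrary: f)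
  case 0
  then show ?case
    by (auto simp: continuous_on_eq_continuous_within intro: has_derivative_continuous)
next
  case (Suc k)
  then show ?case
    by (metis Ck_on.simps(2))
qed

lemma Ck_on_mono: "Ck_on n S f \<Longrightarrow> m \<le> n \<Longrightarrow> Ck_on m S f"
  by (induction n) (auto simp: le_Suc_eq dest: Ck_on_SucD simp del: Ck_on.simps)

lemma Ck_on_cong:
  assumes "\<And>p. p \<in> S \<Longrightarrow> f p = g p"
  shows "Ck_on k S f \<longleftrightarrow> Ck_on k S g"
proof (cases k)
  case 0
  then show ?thesis
    using assms by (auto cong: continuous_on_cong)
next
  case (Suc n)
  have "(f has_derivative f') (at p within S) \<longleftrightarrow> (g has_derivative f') (at p within S)"
    if "p \<in> S" for p f'
    using has_derivative_transform[of p S f g f'] has_derivative_transform[of p S g f f'] assms that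
    by metis
  then show ?thesis
    by (simp add: Suc)
qed

lemma Ck_on_const: "Ck_on k S (\<lambda>p. c)"
proof (induction k arbitrary: c)
  case (Suc k)
  show ?case
    unfolding Ck_on.simps by (rule exI[of _ "\<lambda>p v. 0"]) (use Suc in auto)
qed simp

lemma Ck_on_add:
  assumes "Ck_on k S f" "Ck_on k S g"
  shows "Ck_on k S (\<lambda>p. f p + g p)"
  using assms
proof (induction k arbitrary: f g)
  case 0
  then show ?case by (simp add: continuous_on_add)
next
  case (Suc k)
  obtain f' where f: "\<And>p. p \<in> S \<Longrightarrow> (f has_derivative f' p) (at p within S)"
      "\<And>v. Ck_on k S (\<lambda>p. f' p v)"
    using Suc.prems(1) by auto
  obtain g' where g: "\<And>p. p \<in> S \<Longrightarrow> (g has_derivative g' p) (at p within S)"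
      "\<And>v. Ck_on k S (\<lambda>p. g' p v)"
    using Suc.prems(2) by auto
  show ?case
    unfolding Ck_on.simps
    by (rule exI[of _ "\<lambda>p v. f' p v + g' p v"])
      (auto intro!: Suc.IH f g has_derivative_add)
qed

text \<open>By the product rule each directional derivative is a sum of two products of functions of
  one order less, to which the induction hypothesis applies. Working with a general bounded bilinear
  map treats multiplication, scaling and inner product at once.\<close>

lemma (in bounded_bilinear) Ck_on:
  assumes "Ck_on k S f" "Ck_on k S g"
  shows "Ck_on k S (\<lambda>p. prod (f p) (g p))"
  using assms
proof (induction k arbitrary: f g)
  case 0
  then show ?case by (auto intro: continuous_on)
next
  case (Suc k)
  obtain f' where f: "\<And>p. p \<in> S \<Longrightarrow> (f has_derivative f' p) (at p within S)"
      "\<And>v. Ck_on k S (\<lambda>p. f' p v)"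
    using Suc.prems(1) by auto
  obtain g' where g: "\<And>p. p \<in> S \<Longrightarrow> (g has_derivative g' p) (at p within S)"
      "\<And>v. Ck_on k S (\<lambda>p. g' p v)"
    using Suc.prems(2) by auto
  show ?case
    unfolding Ck_on.simps
    by (rule exI[of _ "\<lambda>p v. prod (f p) (g' p v) + prod (f' p v) (g p)"])
      (auto intro!: Suc.IH f g FDERIV Ck_on_add Ck_on_SucD[OF Suc.prems(1)] Ck_on_SucD[OF Suc.prems(2)])
qed

lemmas Ck_on_mult = bounded_bilinear.Ck_on[OF bounded_bilinear_mult]
lemmas Ck_on_scaleR = bounded_bilinear.Ck_on[OF bounded_bilinear_scaleR]
lemmas Ck_on_inner = bounded_bilinear.Ck_on[OF bounded_bilinear_inner]

lemma Ck_on_diff: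
  assumes "Ck_on k S f" "Ck_on k S g"
  shows "Ck_on k S (\<lambda>p. f p - g p)"
  using Ck_on_add[OF assms(1) Ck_on_scaleR[OF Ck_on_const[of k S "-1"] assms(2)]] by simp

text \<open>The derivative of 1/|f| in direction v is -<f, f' v> |f|^(-3), a product of f, f' v and
  copies of 1/|f| itself. The induction thus closes under products alone, with no chain rule for the
  class.\<close>

lemma Ck_on_inverse_norm:
  fixes f :: "'a::real_normed_vector \<Rightarrow> 'b::real_inner"
  assumes "Ck_on k S f" "\<And>p. p \<in> S \<Longrightarrow> f p \<noteq> 0"
  shows "Ck_on k S (\<lambda>p. inverse (norm (f p)))"
  using assms(1)
proof (induction k)
  case 0
  then show ?case using assms(2) by (auto intro!: continuous_intros)
next
  case (Suc k)
  obtain f' where f: "\<And>p. p \<in> S \<Longrightarrow> (f has_derivative f' p) (at p within S)"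
      "\<And>v. Ck_on k S (\<lambda>p. f' p v)"
    using Suc.prems by auto
  note C = Ck_on_SucD[OF Suc.prems] Suc.IH[OF Ck_on_SucD[OF Suc.prems]]
  let ?h = "\<lambda>p. inverse (norm (f p))"
  have d: "(?h has_derivative (\<lambda>v. (- 1) * ((f p \<bullet> f' p v) * (?h p * (?h p * ?h p))))) (at p within S)"
    if p: "p \<in> S" for p
  proof -
    have "((\<lambda>p. norm (f p)) has_derivative (\<lambda>v. f' p v \<bullet> sgn (f p))) (at p within S)"
      using has_derivative_in_compose[OF f(1)[OF p] has_derivative_at_withinI[OF has_derivative_norm[OF assms(2)[OF p]]]]
      by simp
    from Deriv.has_derivative_inverse[OF _ this] show ?thesis
      using assms(2)[OF p]
      by (auto elim!: has_derivative_eq_rhs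
          simp: sgn_div_norm inner_commute field_simps power2_eq_square fun_eq_iff)
  qed
  show ?case
    unfolding Ck_on.simps
    by (intro exI[of _ "\<lambda>p v. (- 1) * ((f p \<bullet> f' p v) * (?h p * (?h p * ?h p)))"] conjI ballI allI
        d Ck_on_mult Ck_on_inner Ck_on_const C f)
qed

section \<open>Partial derivatives of time-dependent functions\<close>

locale time_interval =
  fixes T :: real
  assumes T_pos: "0 < T"
begin

definition smooth :: "nat \<Rightarrow> (real \<Rightarrow> real \<Rightarrow> 'a::real_normed_vector) \<Rightarrow> bool" where
  "smooth k \<phi> \<longleftrightarrow> Ck_on k ({0..<T} \<times> UNIV) (\<lambda>(t, x). \<phi> t x)"

definition dx :: "(real \<Rightarrow> real \<Rightarrow> 'a::real_normed_vector) \<Rightarrow> real \<Rightarrow> real \<Rightarrow> 'a" where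
  "dx \<phi> t x = vector_derivative (\<phi> t) (at x)"

definition dt :: "(real \<Rightarrow> real \<Rightarrow> 'a::real_normed_vector) \<Rightarrow> real \<Rightarrow> real \<Rightarrow> 'a" where
  "dt \<phi> t x = vector_derivative (\<lambda>\<tau>. \<phi> \<tau> x) (at t within {0..<T})"

text \<open>Since T > 0, the time filter is nontrivial even at t = 0, which makes one-sided time
  derivatives unique.\<close>

lemma at_within_interval: "t \<in> {0..<T} \<Longrightarrow> at t within {0..<T} \<noteq> bot"
  using T_pos by (auto simp: trivial_limit_within islimpt_Ico)

lemma smooth_mono: "smooth n \<phi> \<Longrightarrow> m \<le> n \<Longrightarrow> smooth m \<phi>"
  unfolding smooth_def by (rule Ck_on_mono)

lemma smooth_cong:
  assumes "\<And>t x. t \<in> {0..<T} \<Longrightarrow> \<phi> t x = \<psi> t x"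
  shows "smooth k \<phi> \<longleftrightarrow> smooth k \<psi>"
  unfolding smooth_def by (rule Ck_on_cong) (use assms in auto)

lemma smooth_const: "smooth k (\<lambda>t x. c)"
  unfolding smooth_def case_prod_beta by (rule Ck_on_const)

lemma smooth_add: "smooth k \<phi> \<Longrightarrow> smooth k \<psi> \<Longrightarrow> smooth k (\<lambda>t x. \<phi> t x + \<psi> t x)"
  unfolding smooth_def case_prod_beta by (rule Ck_on_add)

lemma smooth_diff: "smooth k \<phi> \<Longrightarrow> smooth k \<psi> \<Longrightarrow> smooth k (\<lambda>t x. \<phi> t x - \<psi> t x)"
  unfolding smooth_def case_prod_beta by (rule Ck_on_diff)

lemma smooth_mult:
  fixes \<phi> \<psi> :: "real \<Rightarrow> real \<Rightarrow> real"
  shows "smooth k \<phi> \<Longrightarrow> smooth k \<psi> \<Longrightarrow> smooth k (\<lambda>t x. \<phi> t x * \<psi> t x)"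
  unfolding smooth_def case_prod_beta by (rule Ck_on_mult)

lemma smooth_scaleR: "smooth k \<phi> \<Longrightarrow> smooth k \<psi> \<Longrightarrow> smooth k (\<lambda>t x. \<phi> t x *\<^sub>R \<psi> t x)"
  unfolding smooth_def case_prod_beta by (rule Ck_on_scaleR)

lemma smooth_inner: "smooth k \<phi> \<Longrightarrow> smooth k \<psi> \<Longrightarrow> smooth k (\<lambda>t x. \<phi> t x \<bullet> \<psi> t x)"
  unfolding smooth_def case_prod_beta by (rule Ck_on_inner)

lemma smooth_inverse_norm:
  fixes \<phi> :: "real \<Rightarrow> real \<Rightarrow> 'a::real_inner"
  assumes "smooth k \<phi>" "\<And>t x. t \<in> {0..<T} \<Longrightarrow> \<phi> t x \<noteq> 0"
  shows "smooth k (\<lambda>t x. inverse (norm (\<phi> t x)))"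
  using assms unfolding smooth_def case_prod_beta by (auto intro!: Ck_on_inverse_norm)

lemmas smooth_intros = smooth_const smooth_add smooth_diff smooth_mult smooth_scaleR smooth_inner

lemma smooth_continuous_on:
  "smooth k \<phi> \<Longrightarrow> continuous_on ({0..<T} \<times> UNIV) (\<lambda>(t, x). \<phi> t x)"
  unfolding smooth_def using Ck_on_mono[of k _ _ 0] by auto

lemma smooth_continuous_on_x:
  assumes "smooth k \<phi>" "t \<in> {0..<T}"
  shows "continuous_on A (\<phi> t)"
proof -
  have "continuous_on A ((\<lambda>(t, x). \<phi> t x) \<circ> (\<lambda>x. (t, x)))"
    by (rule continuous_on_compose)
      (use assms in \<open>auto intro!: continuous_intros continuous_on_subset[OF smooth_continuous_on]\<close>)
  then show ?thesis
    by (simp add: o_def)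
qed

text \<open>Restricting the joint derivative to the coordinate slices through (t, x) yields both
  partial derivatives as its values on (0, 1) and (1, 0). As functions of the base point these
  values are of class \<open>Ck_on k\<close> by definition.\<close>

lemma smooth_has_derivatives:
  fixes \<phi> :: "real \<Rightarrow> real \<Rightarrow> 'a::real_normed_vector"
  assumes "smooth (Suc k) \<phi>"
  obtains f' :: "real \<times> real \<Rightarrow> real \<times> real \<Rightarrow> 'a" where
    "\<And>v. Ck_on k ({0..<T} \<times> UNIV) (\<lambda>p. f' p v)"
    "\<And>t x. t \<in> {0..<T} \<Longrightarrow> (\<phi> t has_vector_derivative f' (t, x) (0, 1)) (at x)"
    "\<And>t x. t \<in> {0..<T} \<Longrightarrow> ((\<lambda>\<tau>. \<phi> \<tau> x) has_vector_derivative f' (t, x) (1, 0)) (at t within {0..<T})"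
proof -
  let ?S = "{0..<T} \<times> (UNIV :: real set)"
  obtain f' where d: "\<And>p. p \<in> ?S \<Longrightarrow> ((\<lambda>(t, x). \<phi> t x) has_derivative f' p) (at p within ?S)"
    and C: "\<And>v. Ck_on k ?S (\<lambda>p. f' p v)"
    using assms unfolding smooth_def by auto
  show thesis
  proof (rule that[of f'])
    show "Ck_on k ?S (\<lambda>p. f' p v)" for v
      by (rule C)
  next
    fix t x :: real assume t: "t \<in> {0..<T}"
    have "linear (f' (t, x))"
      \<comment> \<open>Linearity brings the derivative along a slice into the form h times a fixed
        vector that a vector derivative requires.\<close>
      using d[of "(t, x)"] t by (auto dest: has_derivative_linear)
    then have lin: "f' (t, x) (0, h) = h *\<^sub>R f' (t, x) (0, 1)" "f' (t, x) (h, 0) = h *\<^sub>R f' (t, x) (1, 0)" for h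
      using linear_cmul[of "f' (t, x)" h "(0, 1)"] linear_cmul[of "f' (t, x)" h "(1, 0)"] by simp_all
    have "((\<lambda>y. (t, y)) has_derivative (\<lambda>h. (0, h))) (at x)"
      by (auto intro!: derivative_eq_intros)
    moreover have "((\<lambda>(t, x). \<phi> t x) has_derivative f' (t, x)) (at (t, x) within (\<lambda>y. (t, y)) ` UNIV)"
      by (rule has_derivative_subset[OF d]) (use t in auto)
    ultimately have "((\<lambda>y. \<phi> t y) has_derivative (\<lambda>h. f' (t, x) (0, h))) (at x)"
      using has_derivative_in_compose[of "\<lambda>y. (t, y)" _ x UNIV "\<lambda>(t, x). \<phi> t x"] by simp
    then show "(\<phi> t has_vector_derivative f' (t, x) (0, 1)) (at x)"
      unfolding has_vector_derivative_def
      by (rule has_derivative_eq_rhs) (rule ext, rule lin(1))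
    have "((\<lambda>\<tau>. (\<tau>, x)) has_derivative (\<lambda>h. (h, 0))) (at t within {0..<T})"
      by (auto intro!: derivative_eq_intros)
    moreover have "((\<lambda>(t, x). \<phi> t x) has_derivative f' (t, x)) (at (t, x) within (\<lambda>\<tau>. (\<tau>, x)) ` {0..<T})"
      by (rule has_derivative_subset[OF d]) (use t in auto)
    ultimately have "((\<lambda>\<tau>. \<phi> \<tau> x) has_derivative (\<lambda>h. f' (t, x) (h, 0))) (at t within {0..<T})"
      using has_derivative_in_compose[of "\<lambda>\<tau>. (\<tau>, x)" _ t "{0..<T}" "\<lambda>(t, x). \<phi> t x"] by simp
    then show "((\<lambda>\<tau>. \<phi> \<tau> x) has_vector_derivative f' (t, x) (1, 0)) (at t within {0..<T})"
      unfolding has_vector_derivative_def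
      by (rule has_derivative_eq_rhs) (rule ext, rule lin(2))
  qed
qed

lemma dt_eqI:
  assumes "((\<lambda>\<tau>. \<phi> \<tau> x) has_vector_derivative d) (at t within {0..<T})" "t \<in> {0..<T}"
  shows "dt \<phi> t x = d"
  unfolding dt_def
  by (rule vector_derivative_within[OF at_within_interval[OF assms(2)] assms(1)])

lemma
  fixes \<phi> :: "real \<Rightarrow> real \<Rightarrow> 'a::real_normed_vector"
  assumes "smooth (Suc k) \<phi>"
  shows has_dx: "t \<in> {0..<T} \<Longrightarrow> (\<phi> t has_vector_derivative dx \<phi> t x) (at x)"
    and has_dt: "t \<in> {0..<T} \<Longrightarrow>
      ((\<lambda>\<tau>. \<phi> \<tau> x) has_vector_derivative dt \<phi> t x) (at t within {0..<T})"
    and smooth_dx: "smooth k (dx \<phi>)"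
    and smooth_dt: "smooth k (dt \<phi>)"
proof -
  obtain f' :: "real \<times> real \<Rightarrow> real \<times> real \<Rightarrow> 'a"
    where C: "\<And>v. Ck_on k ({0..<T} \<times> UNIV) (\<lambda>p. f' p v)"
    and x: "\<And>t x. t \<in> {0..<T} \<Longrightarrow> (\<phi> t has_vector_derivative f' (t, x) (0, 1)) (at x)"
    and t: "\<And>t x. t \<in> {0..<T} \<Longrightarrow>
      ((\<lambda>\<tau>. \<phi> \<tau> x) has_vector_derivative f' (t, x) (1, 0)) (at t within {0..<T})"
    using smooth_has_derivatives[OF assms] by metis
  have dx: "dx \<phi> t x = f' (t, x) (0, 1)" if "t \<in> {0..<T}" for t x
    unfolding dx_def by (rule vector_derivative_at[OF x[OF that]])
  have dt: "dt \<phi> t x = f' (t, x) (1, 0)" if "t \<in> {0..<T}" for t x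
    by (rule dt_eqI[OF t[OF that] that])
  show "(\<phi> t has_vector_derivative dx \<phi> t x) (at x)"
    and "((\<lambda>\<tau>. \<phi> \<tau> x) has_vector_derivative dt \<phi> t x) (at t within {0..<T})" if "t \<in> {0..<T}"
    unfolding dx[OF that] dt[OF that] by (rule x[OF that], rule t[OF that])
  show "smooth k (dx \<phi>)" "smooth k (dt \<phi>)"
    unfolding smooth_def
    by (rule iffD2[OF Ck_on_cong C], auto simp: dx dt)+
qed

text \<open>Differentiating \<open>\<phi> t x = \<phi> t a + \<integral>\<^sub>a\<^sup>x \<phi>\<^sub>x t\<close> under the integral sign gives the symmetry
  of the mixed derivatives also at the boundary time \<open>t = 0\<close>.\<close>

lemma dt_dx_commute:
  fixes \<phi> :: "real \<Rightarrow> real \<Rightarrow> 'a::euclidean_space"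
  assumes "smooth (Suc (Suc k)) \<phi>" "t \<in> {0..<T}"
  shows "dt (dx \<phi>) t x = dx (dt \<phi>) t x"
proof -
  \<comment> \<open>Any compact interval with x in its interior would do: the base point
    \<open>?a\<close> stays fixed, and at an interior point the derivative within the interval is
    the two-sided one.\<close>
  let ?I = "{0..<T}" and ?a = "x - 1" and ?b = "x + 1"
  note s1 = smooth_dx[OF assms(1)]
  note s2 = smooth_dt[OF s1]
  have ftc: "((dx \<phi> \<tau>) has_integral \<phi> \<tau> y - \<phi> \<tau> ?a) (cbox ?a y)"
    if "\<tau> \<in> ?I" "?a \<le> y" for \<tau> y
    unfolding box_real
    by (rule fundamental_theorem_of_calculus[OF that(2)])
      (rule has_vector_derivative_at_within[OF has_dx[OF assms(1) that(1)]])
  have *: "dt \<phi> t y = dt \<phi> t ?a + integral {?a..y} (dt (dx \<phi>) t)" if y: "y \<in> {?a..?b}" for y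
  proof (rule dt_eqI[OF _ assms(2)])
    have "((\<lambda>\<tau>. integral (cbox ?a y) (dx \<phi> \<tau>)) has_vector_derivative
        integral (cbox ?a y) (dt (dx \<phi>) t)) (at t within ?I)"
    proof (rule leibniz_rule_vector_derivative)
      show "continuous_on (?I \<times> cbox ?a y) (\<lambda>(t, x). dt (dx \<phi>) t x)"
        by (rule continuous_on_subset[OF smooth_continuous_on[OF s2]]) auto
      show "dx \<phi> \<tau> integrable_on cbox ?a y" if "\<tau> \<in> ?I" for \<tau>
        using ftc[OF that] y by auto
    qed (use assms(2) has_dt[OF s1] in auto)
    then have "((\<lambda>\<tau>. \<phi> \<tau> ?a + integral (cbox ?a y) (dx \<phi> \<tau>)) has_vector_derivative
        dt \<phi> t ?a + integral (cbox ?a y) (dt (dx \<phi>) t)) (at t within ?I)"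
      by (intro has_vector_derivative_add has_dt[OF assms])
    then show "((\<lambda>\<tau>. \<phi> \<tau> y) has_vector_derivative
        dt \<phi> t ?a + integral {?a..y} (dt (dx \<phi>) t)) (at t within ?I)"
      unfolding box_real
      by (rule has_vector_derivative_transform[rotated 2])
        (use assms(2) y integral_unique[OF ftc] in auto)
  qed
  have "((\<lambda>y. dt \<phi> t ?a + integral {?a..y} (dt (dx \<phi>) t)) has_vector_derivative 0 + dt (dx \<phi>) t x)
      (at x within {?a..?b})"
    by (intro has_vector_derivative_add has_vector_derivative_const integral_has_vector_derivative
        smooth_continuous_on_x[OF s2 assms(2)]) auto
  then have "((\<lambda>y. dt \<phi> t ?a + integral {?a..y} (dt (dx \<phi>) t)) has_vector_derivative dt (dx \<phi>) t x)
      (at x within {?a..?b})"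
    by simp
  then have "(dt \<phi> t has_vector_derivative dt (dx \<phi>) t x) (at x within {?a..?b})"
    by (rule has_vector_derivative_transform[rotated 2]) (simp, rule *)
  then have "(dt \<phi> t has_vector_derivative dt (dx \<phi>) t x) (at x)"
    by (simp add: at_within_Icc_at)
  then show ?thesis
    by (simp add: dx_def vector_derivative_at)
qed

section \<open>Periodicity in space\<close>

definition periodic :: "(real \<Rightarrow> real \<Rightarrow> 'a) \<Rightarrow> bool" where
  "periodic \<phi> \<longleftrightarrow> (\<forall>t\<in>{0..<T}. \<forall>x. \<phi> t (x + 2 * pi) = \<phi> t x)"

lemma periodicD: "periodic \<phi> \<Longrightarrow> t \<in> {0..<T} \<Longrightarrow> \<phi> t (x + 2 * pi) = \<phi> t x"
  by (simp add: periodic_def)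

lemma periodic_dx:
  assumes "smooth (Suc k) \<phi>" "periodic \<phi>"
  shows "periodic (dx \<phi>)"
  unfolding periodic_def
proof (intro ballI allI)
  fix t x assume t: "t \<in> {0..<T}"
  have "((\<lambda>y. y + 2 * pi) has_vector_derivative 1) (at x)"
    by (auto intro!: derivative_eq_intros)
  from vector_diff_chain_at[OF this has_dx[OF assms(1) t]]
  have "(\<phi> t has_vector_derivative dx \<phi> t (x + 2 * pi)) (at x)"
    using periodicD[OF assms(2) t] by (simp add: o_def)
  then show "dx \<phi> t (x + 2 * pi) = dx \<phi> t x"
    using has_dx[OF assms(1) t] vector_derivative_unique_at by blast
qed

lemma periodic_dt:
  assumes "smooth (Suc k) \<phi>" "periodic \<phi>"
  shows "periodic (dt \<phi>)"
  unfolding periodic_def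
proof (intro ballI allI)
  fix t x assume t: "t \<in> {0..<T}"
  have "((\<lambda>\<tau>. \<phi> \<tau> (x + 2 * pi)) has_vector_derivative dt \<phi> t x) (at t within {0..<T})"
    by (rule has_vector_derivative_transform[OF t periodicD[OF assms(2)] has_dt[OF assms(1) t]])
  then show "dt \<phi> t (x + 2 * pi) = dt \<phi> t x"
    by (rule dt_eqI[OF _ t])
qed

end

section \<open>Families of regular curves\<close>

lemmas has_vector_derivative_inner = bounded_bilinear.has_vector_derivative[OF bounded_bilinear_inner]

text \<open>The order 6 comes from counting: every arc length derivative costs one order, so
  \<open>\<tau>\<close> is of class C^5, \<open>\<kappa>\<close> of class C^4, the elastic gradient
  of class C^2 and its normal derivative of class C^1, which still has to be differentiated once in
  the flow equation.\<close>

locale curve_family = time_interval T for T +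
  fixes \<gamma> :: "real \<Rightarrow> real \<Rightarrow> real ^ 2"
  assumes smooth_curve: "smooth 6 \<gamma>"
    and regular: "t \<in> {0..<T} \<Longrightarrow> regular_closed_curve (\<gamma> t)"
begin

definition g :: "real \<Rightarrow> real \<Rightarrow> real" where
  "g t x = speed (\<gamma> t) x"

definition D :: "(real \<Rightarrow> real \<Rightarrow> real ^ 2) \<Rightarrow> real \<Rightarrow> real \<Rightarrow> real ^ 2" where
  "D \<phi> t x = arc_deriv (\<gamma> t) (\<phi> t) x"

definition N :: "(real \<Rightarrow> real \<Rightarrow> real ^ 2) \<Rightarrow> real \<Rightarrow> real \<Rightarrow> real ^ 2" where
  "N \<phi> t x = nabla_s (\<gamma> t) (\<phi> t) x"

definition \<tau> :: "real \<Rightarrow> real \<Rightarrow> real ^ 2" where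
  "\<tau> = D \<gamma>"

definition \<kappa> :: "real \<Rightarrow> real \<Rightarrow> real ^ 2" where
  "\<kappa> = D \<tau>"

lemma g_eq: "g t x = norm (dx \<gamma> t x)"
  by (simp add: g_def speed_def dx_def)

lemma D_eq: "D \<phi> t x = inverse (g t x) *\<^sub>R dx \<phi> t x"
  by (simp add: D_def arc_deriv_def g_def dx_def divide_inverse)

lemma tangent_eq: "tangent (\<gamma> t) = \<tau> t"
  by (simp add: fun_eq_iff tangent_def \<tau>_def D_def)

lemma curvature_eq: "curvature (\<gamma> t) = \<kappa> t"
  unfolding curvature_def \<kappa>_def \<tau>_def D_def ..

lemma N_eq: "N \<phi> t x = D \<phi> t x - (D \<phi> t x \<bullet> \<tau> t x) *\<^sub>R \<tau> t x"
  by (simp add: N_def nabla_s_def normal_proj_def tangent_eq D_def)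

lemma g_pos: "t \<in> {0..<T} \<Longrightarrow> g t x > 0"
  using regular by (simp add: g_eq dx_def regular_closed_curve_def)

lemma smooth_\<gamma>: "k \<le> 6 \<Longrightarrow> smooth k \<gamma>"
  by (rule smooth_mono[OF smooth_curve])

lemma smooth_inverse_g: "k \<le> 5 \<Longrightarrow> smooth k (\<lambda>t x. inverse (g t x))"
proof (rule smooth_mono)
  have "smooth 5 (dx \<gamma>)"
    by (intro smooth_dx smooth_\<gamma>) simp
  from smooth_inverse_norm[OF this] show "smooth 5 (\<lambda>t x. inverse (g t x))"
    using g_pos by (force simp: g_eq)
qed

lemma smooth_D:
  assumes "smooth (Suc k) \<phi>" "k \<le> 5"
  shows "smooth k (D \<phi>)"
  using smooth_scaleR[OF smooth_inverse_g[OF assms(2)] smooth_dx[OF assms(1)]]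
  by (simp add: D_eq[abs_def])

text \<open>The closure rules cover inner products and inverse norms but not norms, so the speed is
  written as |\<open>dx \<gamma>\<close>|^2 times its own inverse.\<close>

lemma smooth_g:
  assumes "k \<le> 5"
  shows "smooth k g"
proof -
  have "smooth k (\<lambda>t x. (dx \<gamma> t x \<bullet> dx \<gamma> t x) * inverse (g t x))"
    using assms by (intro smooth_intros smooth_dx smooth_inverse_g smooth_\<gamma>) simp_all
  then show ?thesis
    by (rule iffD1[OF smooth_cong, rotated]) (use g_pos in \<open>force simp: g_eq dot_square_norm power2_eq_square\<close>)
qed

lemma smooth_\<tau>: "k \<le> 5 \<Longrightarrow> smooth k \<tau>"
  unfolding \<tau>_def by (intro smooth_D smooth_\<gamma>) simp_all

lemma smooth_\<kappa>: "k \<le> 4 \<Longrightarrow> smooth k \<kappa>"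
  unfolding \<kappa>_def by (intro smooth_D smooth_\<tau>) simp_all

lemma smooth_N:
  assumes "smooth (Suc k) \<phi>" "k \<le> 5"
  shows "smooth k (N \<phi>)"
  unfolding N_eq[abs_def] using assms by (intro smooth_intros smooth_D smooth_\<tau>) auto

lemmas smooth_rules = smooth_intros smooth_dx smooth_dt smooth_D smooth_N smooth_\<gamma> smooth_g smooth_\<tau> smooth_\<kappa>

lemma dx_eq: "t \<in> {0..<T} \<Longrightarrow> dx \<phi> t x = g t x *\<^sub>R D \<phi> t x"
  using g_pos[of t x] by (simp add: D_eq)

lemma has_D:
  assumes "smooth (Suc k) \<phi>" "t \<in> {0..<T}"
  shows "(\<phi> t has_vector_derivative g t x *\<^sub>R D \<phi> t x) (at x)"
  using has_dx[OF assms, of x] by (simp only: dx_eq[OF assms(2)])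

lemma D_eqI:
  assumes "(\<phi> t has_vector_derivative g t x *\<^sub>R d) (at x)" "t \<in> {0..<T}"
  shows "D \<phi> t x = d"
  using vector_derivative_at[OF assms(1)] g_pos[OF assms(2), of x] by (simp add: D_eq dx_def)

lemma has_D_inner:
  assumes "smooth (Suc k) \<phi>" "smooth (Suc j) \<psi>" "t \<in> {0..<T}"
  shows "((\<lambda>x. \<phi> t x \<bullet> \<psi> t x) has_vector_derivative g t x * (D \<phi> t x \<bullet> \<psi> t x + \<phi> t x \<bullet> D \<psi> t x)) (at x)"
  using has_vector_derivative_inner[OF has_D[OF assms(1,3)] has_D[OF assms(2,3)], of x]
  by (simp add: algebra_simps)

text \<open>The device for differentiating pointwise identities along the curve: the factor g is
  positive and cancels.\<close>

lemma const_derivative_eq_0: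
  fixes f :: "real \<Rightarrow> real"
  assumes "(f has_vector_derivative g t x * d) (at x)" "\<And>x. f x = c" "t \<in> {0..<T}"
  shows "d = 0"
proof -
  have "f = (\<lambda>x. c)"
    using assms(2) by auto
  then have "g t x * d = 0"
    using assms(1) vector_derivative_unique_at[OF assms(1), of 0] by simp
  then show ?thesis
    using g_pos[OF assms(3), of x] by simp
qed

section \<open>Frame identities and time evolution at a fixed time\<close>

context
  fixes t assumes t: "t \<in> {0..<T}"
begin

lemma tangent_unit: "\<tau> t x \<bullet> \<tau> t x = 1"
proof -
  have "norm (\<tau> t x) = 1"
    using g_pos[OF t, of x] by (simp add: \<tau>_def D_eq flip: g_eq)
  then show ?thesis by (simp add: dot_square_norm)
qed

text \<open>This identity and the next two arise by differentiating along the curve, each from its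
  predecessor, starting with <\<tau>, \<tau>> = 1.\<close>

lemma tangent_curvature: "\<tau> t x \<bullet> \<kappa> t x = 0"
proof -
  have "smooth (Suc 0) \<tau>" by (simp add: smooth_\<tau>)
  from const_derivative_eq_0[OF has_D_inner[OF this this t] tangent_unit t, of x] show ?thesis
    by (simp add: \<kappa>_def inner_commute)
qed

lemma tangent_D_curvature: "\<tau> t x \<bullet> D \<kappa> t x = - (\<kappa> t x \<bullet> \<kappa> t x)"
proof -
  have "smooth (Suc 0) \<tau>" "smooth (Suc 0) \<kappa>" by (simp_all add: smooth_\<tau> smooth_\<kappa>)
  from const_derivative_eq_0[OF has_D_inner[OF this t] tangent_curvature t, of x] show ?thesis
    by (simp add: \<kappa>_def)
qed

lemma tangent_DD_curvature: "\<tau> t x \<bullet> D (D \<kappa>) t x = - 3 * (\<kappa> t x \<bullet> D \<kappa> t x)"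
proof -
  have s: "smooth (Suc 0) \<tau>" "smooth (Suc 0) \<kappa>" "smooth (Suc 0) (D \<kappa>)"
    by (simp_all add: smooth_\<tau> smooth_\<kappa> smooth_D)
  have "((\<lambda>x. \<tau> t x \<bullet> D \<kappa> t x + \<kappa> t x \<bullet> \<kappa> t x) has_vector_derivative
      g t x * ((\<kappa> t x \<bullet> D \<kappa> t x + \<tau> t x \<bullet> D (D \<kappa>) t x) + 2 * (\<kappa> t x \<bullet> D \<kappa> t x))) (at x)"
    using has_vector_derivative_add[OF has_D_inner[OF s(1,3) t, of x] has_D_inner[OF s(2,2) t, of x]]
    by (simp add: \<kappa>_def[symmetric] inner_commute algebra_simps)
  from const_derivative_eq_0[OF this _ t, of 0] show ?thesis
    by (simp add: tangent_D_curvature)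
qed

lemma N_curvature: "N \<kappa> t x = D \<kappa> t x + (\<kappa> t x \<bullet> \<kappa> t x) *\<^sub>R \<tau> t x"
  using tangent_D_curvature[of x] by (simp add: N_eq inner_commute)

text \<open>Differentiating \<open>N_curvature\<close> gives a tangential coefficient 2 <\<kappa>, D
  \<kappa>> next to D (D \<kappa>), whose own tangential part is -3 <\<kappa>, D \<kappa>>. The
  projection removes the total of -1 <\<kappa>, D \<kappa>>, which turns the 2 into 3.\<close>

lemma NN_curvature:
  "N (N \<kappa>) t x = D (D \<kappa>) t x + (\<kappa> t x \<bullet> \<kappa> t x) *\<^sub>R \<kappa> t x + (3 * (\<kappa> t x \<bullet> D \<kappa> t x)) *\<^sub>R \<tau> t x"
proof -
  have s: "smooth (Suc 0) \<tau>" "smooth (Suc 0) \<kappa>" "smooth (Suc 0) (D \<kappa>)"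
    by (simp_all add: smooth_\<tau> smooth_\<kappa> smooth_D)
  have eq: "N \<kappa> t = (\<lambda>x. D \<kappa> t x + (\<kappa> t x \<bullet> \<kappa> t x) *\<^sub>R \<tau> t x)"
    by (rule ext) (rule N_curvature)
  have "D (N \<kappa>) t x = D (D \<kappa>) t x + ((\<kappa> t x \<bullet> \<kappa> t x) *\<^sub>R \<kappa> t x + (2 * (\<kappa> t x \<bullet> D \<kappa> t x)) *\<^sub>R \<tau> t x)"
  proof (rule D_eqI[OF _ t])
    note has_D_inner[OF s(2,2) t, of x, unfolded has_real_derivative_iff_has_vector_derivative[symmetric]]
    from has_vector_derivative_add[OF has_D[OF s(3) t, of x]
        has_vector_derivative_scaleR[OF this has_D[OF s(1) t, of x]]]
    show "(N \<kappa> t has_vector_derivative g t x *\<^sub>R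
        (D (D \<kappa>) t x + ((\<kappa> t x \<bullet> \<kappa> t x) *\<^sub>R \<kappa> t x + (2 * (\<kappa> t x \<bullet> D \<kappa> t x)) *\<^sub>R \<tau> t x))) (at x)"
      unfolding eq by (simp add: \<kappa>_def[symmetric] inner_commute algebra_simps)
  qed
  then show ?thesis
    using tangent_unit[of x] tangent_curvature[of x] tangent_DD_curvature[of x]
    by (simp add: N_eq inner_commute inner_simps) (simp add: algebra_simps flip: scaleR_left_distrib)
qed

text \<open>The identity g^2 = <\<open>dx \<gamma>\<close>, \<open>dx \<gamma>\<close>> is
  differentiated in time by the product rule. Exchanging the mixed derivatives and inserting
  \<open>dx \<gamma>\<close> = g \<tau> then leaves a common factor g to cancel.\<close>

lemma dt_g: "dt g t x = g t x * (\<tau> t x \<bullet> D (dt \<gamma>) t x)"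
proof -
  have s: "smooth (Suc (Suc 0)) \<gamma>" "smooth (Suc 0) (dx \<gamma>)" "smooth (Suc 0) g"
    by (intro smooth_rules; simp)+
  have "((\<lambda>\<tau>. g \<tau> x * g \<tau> x) has_vector_derivative dx \<gamma> t x \<bullet> dt (dx \<gamma>) t x + dt (dx \<gamma>) t x \<bullet> dx \<gamma> t x)
      (at t within {0..<T})"
    using has_vector_derivative_inner[OF has_dt[OF s(2) t, of x] has_dt[OF s(2) t, of x]]
    by (simp add: g_eq dot_square_norm power2_eq_square)
  moreover have "((\<lambda>\<tau>. g \<tau> x * g \<tau> x) has_vector_derivative g t x * dt g t x + dt g t x * g t x)
      (at t within {0..<T})"
    by (rule has_vector_derivative_mult[OF has_dt[OF s(3) t] has_dt[OF s(3) t]])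
  ultimately have "2 * (dx \<gamma> t x \<bullet> dt (dx \<gamma>) t x) = 2 * (g t x * dt g t x)"
    using vector_derivative_unique_within[OF at_within_interval[OF t]]
    by (fastforce simp: inner_commute)
  then show ?thesis
    using g_pos[OF t, of x] by (simp add: dt_dx_commute[OF s(1) t] dx_eq[OF t] \<tau>_def)
qed

text \<open>The commutator of the time and arc length derivatives. It comes from computing the time
  derivative of \<open>dx \<phi>\<close> = g \<open>D \<phi>\<close> twice, once by exchanging mixed
  derivatives and once by the product rule with \<open>dt_g\<close>.\<close>

lemma dt_D:
  assumes "smooth (Suc (Suc 0)) \<phi>"
  shows "dt (D \<phi>) t x = D (dt \<phi>) t x - (\<tau> t x \<bullet> D (dt \<gamma>) t x) *\<^sub>R D \<phi> t x"
proof -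
  have s: "smooth (Suc 0) g" "smooth (Suc 0) (D \<phi>)"
    using assms by (intro smooth_rules; simp)+
  note has_dt[OF s(1) t, of x, unfolded has_real_derivative_iff_has_vector_derivative[symmetric]]
  from has_vector_derivative_scaleR[OF this has_dt[OF s(2) t, of x]]
  have "((\<lambda>\<tau>. dx \<phi> \<tau> x) has_vector_derivative g t x *\<^sub>R dt (D \<phi>) t x + dt g t x *\<^sub>R D \<phi> t x)
      (at t within {0..<T})"
    by (rule has_vector_derivative_transform[rotated 2]) (use t dx_eq in auto)
  from dt_eqI[where \<phi> = "dx \<phi>", OF this t]
  have "g t x *\<^sub>R D (dt \<phi>) t x = g t x *\<^sub>R dt (D \<phi>) t x + dt g t x *\<^sub>R D \<phi> t x"
    by (simp only: dt_dx_commute[OF assms t] dx_eq[OF t])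
  then have "g t x *\<^sub>R dt (D \<phi>) t x = g t x *\<^sub>R (D (dt \<phi>) t x - (\<tau> t x \<bullet> D (dt \<gamma>) t x) *\<^sub>R D \<phi> t x)"
    by (simp add: dt_g scaleR_diff_right)
  then show ?thesis
    using g_pos[OF t, of x] by simp
qed

text \<open>The commutator is applied twice, to \<gamma> for the evolution of \<tau> and to \<tau>
  for that of \<kappa>. Each application contributes one term -<\<tau>, D (dt \<gamma>)> \<kappa>,
  hence the factor 2; the remaining correction is tangential and vanishes against \<kappa>.\<close>

lemma curvature_dt_curvature:
  "\<kappa> t x \<bullet> dt \<kappa> t x = \<kappa> t x \<bullet> D (D (dt \<gamma>)) t x - 2 * (\<kappa> t x \<bullet> \<kappa> t x) * (\<tau> t x \<bullet> D (dt \<gamma>) t x)"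
proof -
  let ?V1 = "D (dt \<gamma>)"
  have s: "smooth (Suc (Suc 0)) \<gamma>" "smooth (Suc (Suc 0)) \<tau>" "smooth (Suc 0) \<tau>" "smooth (Suc 0) ?V1"
    by (intro smooth_rules; simp)+
  have eq: "dt \<tau> t = (\<lambda>x. ?V1 t x - (\<tau> t x \<bullet> ?V1 t x) *\<^sub>R \<tau> t x)"
    using dt_D[OF s(1)] by (simp add: \<tau>_def fun_eq_iff)
  have D_dt: "D (dt \<tau>) t x = D ?V1 t x - ((\<tau> t x \<bullet> ?V1 t x) *\<^sub>R \<kappa> t x
      + (\<kappa> t x \<bullet> ?V1 t x + \<tau> t x \<bullet> D ?V1 t x) *\<^sub>R \<tau> t x)"
    (is "_ = ?d")
  proof (rule D_eqI[OF _ t])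
    note has_D_inner[OF s(3,4) t, of x, unfolded has_real_derivative_iff_has_vector_derivative[symmetric]]
    from has_vector_derivative_diff[OF has_D[OF s(4) t, of x]
        has_vector_derivative_scaleR[OF this has_D[OF s(3) t, of x]]]
    show "(dt \<tau> t has_vector_derivative g t x *\<^sub>R ?d) (at x)"
      unfolding eq by (simp add: \<kappa>_def[symmetric] algebra_simps)
  qed
  have dt_\<kappa>: "dt \<kappa> t x = D (dt \<tau>) t x - (\<tau> t x \<bullet> ?V1 t x) *\<^sub>R \<kappa> t x"
    using dt_D[OF s(2)] by (simp add: \<kappa>_def)
  show ?thesis
    unfolding dt_\<kappa> D_dt inner_diff_right inner_add_right inner_scaleR_right
    by (simp add: tangent_curvature inner_commute[of "\<kappa> t x" "\<tau> t x"])
qed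

end

lemma periodic_curve: "periodic \<gamma>"
  using regular by (simp add: periodic_def regular_closed_curve_def)

lemma periodic_D:
  assumes "smooth (Suc k) \<phi>" "periodic \<phi>"
  shows "periodic (D \<phi>)"
proof -
  have "smooth (Suc 5) \<gamma>"
    using smooth_curve by simp
  from periodic_dx[OF this periodic_curve] periodic_dx[OF assms] show ?thesis
    by (simp add: periodic_def D_eq g_eq)
qed

end

section \<open>Elastic gradient, energy density and dissipation\<close>

locale elastic_flow = curve_family T \<gamma> for T \<gamma> +
  fixes l :: real
  assumes flow: "t \<in> {0..<T} \<Longrightarrow> normal_velocity T \<gamma> t x =
    nabla_s (\<gamma> t) (nabla_s (\<gamma> t) (elastic_gradient l (\<gamma> t))) x"
begin

definition F :: "real \<Rightarrow> real \<Rightarrow> real ^ 2" where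
  "F t x = elastic_gradient l (\<gamma> t) x"

text \<open>Twice the energy density, taken with respect to dx instead of ds so that the domain of
  integration and the measure do not depend on time.\<close>

definition e :: "real \<Rightarrow> real \<Rightarrow> real" where
  "e t x = (\<kappa> t x \<bullet> \<kappa> t x + 2 * l) * g t x"

lemma F_eq_N: "F t x = N (N \<kappa>) t x + (1 / 2 * (\<kappa> t x \<bullet> \<kappa> t x)) *\<^sub>R \<kappa> t x - l *\<^sub>R \<kappa> t x"
  by (simp add: F_def elastic_gradient_def curvature_eq power2_norm_eq_inner N_def[abs_def])

lemma smooth_F: "k \<le> 2 \<Longrightarrow> smooth k F"
  unfolding F_eq_N[abs_def] by (intro smooth_rules) simp_all

text \<open>The coefficient 3/2 adds the 1 from \<open>NN_curvature\<close> to the 1/2 in the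
  gradient. In this form F is the arc length derivative of D \<kappa> + c \<tau> with c = 3/2
  <\<kappa>, \<kappa>> - l, because the derivative of c is 3 <\<kappa>, D \<kappa>>.\<close>

lemma F_eq:
  assumes "t \<in> {0..<T}"
  shows "F t x = D (D \<kappa>) t x + (3 * (\<kappa> t x \<bullet> D \<kappa> t x)) *\<^sub>R \<tau> t x + (3 / 2 * (\<kappa> t x \<bullet> \<kappa> t x) - l) *\<^sub>R \<kappa> t x"
  unfolding F_eq_N NN_curvature[OF assms] by (simp add: algebra_simps flip: scaleR_left_distrib)

lemma tangent_F:
  assumes "t \<in> {0..<T}"
  shows "\<tau> t x \<bullet> F t x = 0"
  using tangent_unit[OF assms, of x] tangent_curvature[OF assms, of x] tangent_DD_curvature[OF assms, of x]
  by (simp add: F_eq[OF assms] inner_simps)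

lemma normal_velocity_eq:
  assumes "t \<in> {0..<T}"
  shows "dt \<gamma> t x - (dt \<gamma> t x \<bullet> \<tau> t x) *\<^sub>R \<tau> t x = N (N F) t x"
  using flow[OF assms, of x]
  by (simp add: normal_velocity_def normal_proj_def tangent_eq dt_def N_def[abs_def] F_def[abs_def])

text \<open>The boundary terms of all integrations by parts: their derivative is
  \<open>\<partial>\<^sub>t e / 2 + |\<nabla>\<^sub>s F|\<^sup>2 g\<close>.\<close>

definition flux :: "real \<Rightarrow> real \<Rightarrow> real" where
  "flux t x = F t x \<bullet> N F t x + \<kappa> t x \<bullet> D (dt \<gamma>) t x
     - (D \<kappa> t x + (3 / 2 * (\<kappa> t x \<bullet> \<kappa> t x) - l) *\<^sub>R \<tau> t x) \<bullet> dt \<gamma> t x"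

lemma smooth_e: "smooth (Suc 0) e"
  unfolding e_def[abs_def] by (intro smooth_rules) simp_all

text \<open>Stretching of the length element contributes <\<kappa>, \<kappa>> + 2 l times <\<tau>, D
  (dt \<gamma>)>, and the change of curvature contributes -4 <\<kappa>, \<kappa>> times the same
  factor. Half the sum is the coefficient -(3/2 <\<kappa>, \<kappa>> - l).\<close>

lemma dt_e:
  assumes t: "t \<in> {0..<T}"
  shows "1 / 2 * dt e t x = g t x * (\<kappa> t x \<bullet> D (D (dt \<gamma>)) t x
    - (3 / 2 * (\<kappa> t x \<bullet> \<kappa> t x) - l) * (\<tau> t x \<bullet> D (dt \<gamma>) t x))"
proof -
  have s: "smooth (Suc 0) \<kappa>" "smooth (Suc 0) g"
    by (intro smooth_rules; simp)+
  have "((\<lambda>\<tau>. e \<tau> x) has_vector_derivative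
      (\<kappa> t x \<bullet> \<kappa> t x + 2 * l) * dt g t x + (\<kappa> t x \<bullet> dt \<kappa> t x + dt \<kappa> t x \<bullet> \<kappa> t x + 0) * g t x)
      (at t within {0..<T})"
    unfolding e_def
    by (intro has_vector_derivative_mult has_vector_derivative_add has_vector_derivative_inner
        has_vector_derivative_const has_dt[OF s(1) t] has_dt[OF s(2) t])
  from dt_eqI[where \<phi> = e, OF this t] show ?thesis
    unfolding dt_g[OF t] inner_commute[of "dt \<kappa> t x"] curvature_dt_curvature[OF t]
    by (simp add: algebra_simps)
qed

lemma has_flux:
  assumes t: "t \<in> {0..<T}"
  shows "(flux t has_vector_derivative 1 / 2 * dt e t x + (norm (N F t x))\<^sup>2 * g t x) (at x)"
proof -
  let ?V = "dt \<gamma>" and ?c = "\<lambda>x. 3 / 2 * (\<kappa> t x \<bullet> \<kappa> t x) - l"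
  have s: "smooth (Suc 0) F" "smooth (Suc 0) (N F)" "smooth (Suc 0) \<kappa>" "smooth (Suc 0) (D ?V)"
    "smooth (Suc 0) (D \<kappa>)" "smooth (Suc 0) \<tau>" "smooth (Suc 0) ?V"
    by (intro smooth_rules smooth_F; simp)+
  note d = has_D_inner[OF s(1,2) t, of x] has_D_inner[OF s(3,4) t, of x] has_D_inner[OF s(3,3) t, of x]
    has_D[OF s(5) t, of x] has_D[OF s(6) t, of x] has_D[OF s(7) t, of x]
  let ?c' = "g t x * (3 * (\<kappa> t x \<bullet> D \<kappa> t x))"
  have c: "(?c has_real_derivative ?c') (at x)"
    using d(3) unfolding has_real_derivative_iff_has_vector_derivative[symmetric]
    by (auto intro!: derivative_eq_intros simp: inner_commute)
  \<comment> \<open>By \<open>F_eq\<close>, the derivative of the first factor is g F.\<close>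
  have V: "((\<lambda>x. (D \<kappa> t x + ?c x *\<^sub>R \<tau> t x) \<bullet> ?V t x) has_vector_derivative
      g t x * (F t x \<bullet> ?V t x + (D \<kappa> t x + ?c x *\<^sub>R \<tau> t x) \<bullet> D ?V t x)) (at x)"
    using has_vector_derivative_inner[OF has_vector_derivative_add[OF d(4)
        has_vector_derivative_scaleR[OF c d(5)]] d(6)]
    by (simp add: F_eq[OF t] \<kappa>_def[symmetric] inner_simps algebra_simps)
  \<comment> \<open>The flow equation is paired with F. As F is normal, the tangential corrections
    on both sides drop out, so the arbitrary tangential velocity disappears.\<close>
  have F: "F t x \<bullet> D (N F) t x = F t x \<bullet> ?V t x"
    using arg_cong[OF normal_velocity_eq[OF t, of x], of "inner (F t x)"] tangent_F[OF t, of x]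
    by (simp add: N_eq[of "N F"] inner_diff_right inner_commute[of "F t x" "\<tau> t x"])
  have "N F t x \<bullet> \<tau> t x = 0"
    using tangent_unit[OF t, of x] by (simp add: N_eq inner_diff_left)
  moreover have "D F t x \<bullet> N F t x = (N F t x + (D F t x \<bullet> \<tau> t x) *\<^sub>R \<tau> t x) \<bullet> N F t x"
    by (simp add: N_eq)
  ultimately have NF: "D F t x \<bullet> N F t x = (norm (N F t x))\<^sup>2"
    by (simp add: inner_add_left inner_commute[of "\<tau> t x"] power2_norm_eq_inner)
  \<comment> \<open>The terms <F, dt \<gamma>> from the first and third products cancel, as do the
    terms <D \<kappa>, D (dt \<gamma>)>. What remains is g |N F|^2 and the expression from
    \<open>dt_e\<close>.\<close>
  have "(flux t has_vector_derivative
      g t x * (D F t x \<bullet> N F t x + F t x \<bullet> D (N F) t x) + g t x * (D \<kappa> t x \<bullet> D ?V t x + \<kappa> t x \<bullet> D (D ?V) t x)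
      - g t x * (F t x \<bullet> ?V t x + (D \<kappa> t x + ?c x *\<^sub>R \<tau> t x) \<bullet> D ?V t x)) (at x)"
    unfolding flux_def[abs_def] by (rule has_vector_derivative_diff[OF has_vector_derivative_add[OF d(1,2)] V])
  then show ?thesis
    unfolding dt_e[OF t] F NF inner_add_left inner_scaleR_left
    by (rule has_vector_derivative_eq_rhs) (simp add: algebra_simps)
qed

text \<open>The curve closes up, and time and arc length derivatives inherit its period. The second
  derivative of \<kappa> enters through \<open>F_eq\<close>.\<close>

lemma flux_periodic:
  assumes t: "t \<in> {0..<T}"
  shows "flux t (2 * pi) = flux t 0"
proof -
  have \<gamma>: "smooth (Suc 5) \<gamma>"
    using smooth_curve by simp
  have V: "periodic (dt \<gamma>)"
    by (rule periodic_dt[OF \<gamma> periodic_curve])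
  then have V1: "periodic (D (dt \<gamma>))"
    by (rule periodic_D[OF smooth_dt[OF smooth_\<gamma>[of "Suc (Suc 0)"]], rotated]) simp
  have \<tau>: "periodic \<tau>"
    unfolding \<tau>_def by (rule periodic_D[OF \<gamma> periodic_curve])
  have \<kappa>: "periodic \<kappa>"
    unfolding \<kappa>_def by (rule periodic_D[OF smooth_\<tau>[of "Suc 0"] \<tau>]) simp
  have \<kappa>1: "periodic (D \<kappa>)"
    by (rule periodic_D[OF smooth_\<kappa>[of "Suc 0"] \<kappa>]) simp
  have \<kappa>2: "periodic (D (D \<kappa>))"
    by (rule periodic_D[OF smooth_D[OF smooth_\<kappa>[of "Suc (Suc 0)"]] \<kappa>1]) simp_all
  note p = V V1 \<tau> \<kappa> \<kappa>1 \<kappa>2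
  have F: "periodic F"
    using p by (simp add: periodic_def F_eq)
  have "periodic (D F)"
    by (rule periodic_D[OF smooth_F[of "Suc 0"] F]) simp
  then have NF: "periodic (N F)"
    using \<tau> by (simp add: periodic_def N_eq)
  show ?thesis
    using p[THEN periodicD, OF t, of 0] F[THEN periodicD, OF t, of 0] NF[THEN periodicD, OF t, of 0]
    by (simp add: flux_def)
qed

text \<open>Differentiation under the integral sign reduces the claim to the integral of
  \<open>dt e\<close> over one period. Integrating \<open>has_flux\<close> over that period, with
  equal end values of \<open>flux\<close>, identifies half of this integral with minus the
  dissipation.\<close>

theorem energy_dissipation:
  assumes t: "t \<in> {0..<T}"
  shows "((\<lambda>\<tau>. elastic_energy l (\<gamma> \<tau>)) has_real_derivative
      - arc_integral (\<gamma> t) (\<lambda>x. (norm (nabla_s (\<gamma> t) (elastic_gradient l (\<gamma> t)) x))\<^sup>2)) (at t within {0..<T})"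
proof -
  let ?I = "{0..<T}" and ?A = "cbox 0 (2 * pi)"
  let ?n = "\<lambda>x. (norm (N F t x))\<^sup>2 * g t x"
  have energy: "elastic_energy l (\<gamma> \<tau>) = 1 / 2 * integral ?A (e \<tau>)" for \<tau>
    by (simp add: elastic_energy_def arc_integral_def e_def[abs_def] curvature_eq power2_norm_eq_inner g_def)
  have n: "arc_integral (\<gamma> t) (\<lambda>x. (norm (nabla_s (\<gamma> t) (elastic_gradient l (\<gamma> t)) x))\<^sup>2) = integral ?A ?n"
    by (simp add: arc_integral_def N_def F_def[abs_def] g_def)
  \<comment> \<open>Continuity makes the dissipation integrable, so that it can be split off from
    the integral of the sum.\<close>
  have "smooth 0 (\<lambda>t x. (N F t x \<bullet> N F t x) * g t x)"
    by (intro smooth_rules smooth_F) simp_all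
  from smooth_continuous_on_x[OF this t, of ?A] have n_int: "?n integrable_on ?A"
    by (simp add: power2_norm_eq_inner integrable_continuous_real)
  have cont_e: "continuous_on (?I \<times> ?A) (\<lambda>(t, x). dt e t x)"
    by (rule continuous_on_subset[OF smooth_continuous_on[OF smooth_dt[OF smooth_e]]]) auto
  have "((\<lambda>\<tau>. integral ?A (e \<tau>)) has_vector_derivative integral ?A (dt e t)) (at t within ?I)"
  proof (rule leibniz_rule_vector_derivative[OF _ _ cont_e t])
    show "e \<tau> integrable_on ?A" if "\<tau> \<in> ?I" for \<tau>
      by (rule integrable_continuous) (rule smooth_continuous_on_x[OF smooth_e that])
  qed (auto intro: has_dt[OF smooth_e])
  then have *: "((\<lambda>\<tau>. elastic_energy l (\<gamma> \<tau>)) has_real_derivative 1 / 2 * integral ?A (dt e t)) (at t within ?I)"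
    unfolding energy has_real_derivative_iff_has_vector_derivative[symmetric]
    by (rule DERIV_cmult)
  have "((\<lambda>x. 1 / 2 * dt e t x + ?n x) has_integral flux t (2 * pi) - flux t 0) {0..2 * pi}"
    by (rule fundamental_theorem_of_calculus)
      (simp, rule has_vector_derivative_at_within[OF has_flux[OF t]])
  then have "((\<lambda>x. 1 / 2 * dt e t x + ?n x) has_integral 0) ?A"
    by (simp add: flux_periodic[OF t])
  from has_integral_diff[OF this integrable_integral[OF n_int]]
  have "integral ?A (\<lambda>x. 1 / 2 * dt e t x) = - integral ?A ?n"
    by (auto dest: integral_unique)
  then show ?thesis
    using * by (simp add: n)
qed

end

theorem lemma3p3:
  "\<exists>k::nat. \<forall>(l::real) (T::real) (\<gamma> :: real \<Rightarrow> real \<Rightarrow> real ^ 2).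
     0 \<le> l \<longrightarrow> 0 < T \<longrightarrow>
     Ck_on k ({0..<T} \<times> UNIV) (\<lambda>(t, x). \<gamma> t x) \<longrightarrow>
     (\<forall>t\<in>{0..<T}. regular_closed_curve (\<gamma> t)) \<longrightarrow>
     (\<forall>t\<in>{0..<T}. \<forall>x. normal_velocity T \<gamma> t x =
        nabla_s (\<gamma> t) (nabla_s (\<gamma> t) (elastic_gradient l (\<gamma> t))) x) \<longrightarrow>
     (\<forall>t\<in>{0..<T}.
        ((\<lambda>\<tau>. elastic_energy l (\<gamma> \<tau>)) has_real_derivative
           - arc_integral (\<gamma> t) (\<lambda>x. (norm (nabla_s (\<gamma> t) (elastic_gradient l (\<gamma> t)) x))\<^sup>2))
          (at t within {0..<T}) \<and>
        - arc_integral (\<gamma> t) (\<lambda>x. (norm (nabla_s (\<gamma> t) (elastic_gradient l (\<gamma> t)) x))\<^sup>2) \<le> 0)"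
proof (intro exI[of _ 6] allI impI ballI conjI)
  fix l T :: real and \<gamma> :: "real \<Rightarrow> real \<Rightarrow> real ^ 2" and t
  assume T: "0 < T" and smooth: "Ck_on 6 ({0..<T} \<times> UNIV) (\<lambda>(t, x). \<gamma> t x)"
    and reg: "\<forall>t\<in>{0..<T}. regular_closed_curve (\<gamma> t)"
    and flow: "\<forall>t\<in>{0..<T}. \<forall>x. normal_velocity T \<gamma> t x =
      nabla_s (\<gamma> t) (nabla_s (\<gamma> t) (elastic_gradient l (\<gamma> t))) x"
    and t: "t \<in> {0..<T}"
  \<comment> \<open>Interpreted first, so that \<open>smooth_def\<close> is available to turn the
    \<open>Ck_on\<close> hypothesis into the assumption of the larger locale.\<close>
  interpret time_interval T
    by unfold_locales (rule T)
  interpret elastic_flow T \<gamma> l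
    by unfold_locales (use smooth reg flow in \<open>auto simp: smooth_def\<close>)
  let ?n = "arc_integral (\<gamma> t) (\<lambda>x. (norm (nabla_s (\<gamma> t) (elastic_gradient l (\<gamma> t)) x))\<^sup>2)"
  show "((\<lambda>\<tau>. elastic_energy l (\<gamma> \<tau>)) has_real_derivative - ?n) (at t within {0..<T})"
    by (rule energy_dissipation[OF t])
  \<comment> \<open>The sign needs no regularity: the integral of a function that is not integrable
    is 0 by convention.\<close>
  have "integral A (\<lambda>x. (norm (f x))\<^sup>2 * norm (h x)) \<ge> 0" for A :: "real set" and f h :: "real \<Rightarrow> real ^ 2"
    by (cases "(\<lambda>x. (norm (f x))\<^sup>2 * norm (h x)) integrable_on A")
      (simp_all add: Henstock_Kurzweil_Integration.integral_nonneg not_integrable_integral)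
  then have "?n \<ge> 0"
    unfolding arc_integral_def speed_def .
  then show "- ?n \<le> 0"
    by simp
qed

end
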